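(* Let $H$ be a finite hypergraph, let $\mathfrak{R}$ be an equivalence relation on $V(H)$, and let $T:\mathbb{C}^{V(H)}\to\mathbb{C}^{V(H)}$ be an $\mathfrak{R}$-compatible linear operator. Then for any $\mathfrak{R}$-equivalence class $W$ with $|W|>1$ and any two distinct vertices $u,v\in W$, the number $(T x_{uv})(v)$ is an eigenvalue of $T$ with an eigenvector $x_{uv}$.
   Context: A (finite) hypergraph $H$ is a pair $(V(H),E(H))$, where $V(H)$ is a non-empty finite set and $E(H)$ is a collection of non-empty subsets of $V(H)$. $\mathbb{C}^{V(H)}$ is the vector space of all functions $V(H)\to\mathbb{C}$. For $U\subseteq V(H)$, $\chi_U$ is the characteristic function of $U$. For distinct $u,v\in V(H)$, $x_{uv}=\chi_{\{v\}}-\chi_{\{u\}}$. For distinct $u,v\in V(H)$, $\phi_{uv}:V(H)\to V(H)$ is the transposition that interchanges $u$ and $v$ and fixes every other vertex. Given an equivalence relation $\mathfrak{R}$ on $V(H)$, a linear map $T:\mathbb{C}^{V(H)}\to\mathbb{C}^{V(H)}$ is called $\mathfrak{R}$-compatible if for every $\mathfrak{R}$-equivalence class $W$, every pair $\{u,v\}\subseteq W$ and every $x\in\mathbb{C}^{V(H)}$, $(Tx)\circ\phi_{uv}=T(x\circ\phi_{uv})$. *)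

theory Defs
  imports Complex_Main "HOL-Library.FuncSet" "HOL-Library.Indicator_Function"
    "HOL-Combinatorics.Transposition"
begin

locale hypergraph =
  fixes V :: "'a set" and E :: "'a set set"
  assumes finite_vertices: "finite V"
    and vertices_nonempty: "V \<noteq> {}"
    and edges_subset: "\<And>e. e \<in> E \<Longrightarrow> e \<subseteq> V"
    and edges_nonempty: "\<And>e. e \<in> E \<Longrightarrow> e \<noteq> {}"

text \<open>
  A function from \<open>V\<close> to the complex numbers is represented by an extensional function, so that
  equality in \<open>fun_space V\<close> is equality of the values on \<open>V\<close>. The vector space operations are
  the pointwise ones, restricted to \<open>V\<close> again.
\<close>

definition fun_space :: "'a set \<Rightarrow> ('a \<Rightarrow> complex) set" where
  "fun_space V = V \<rightarrow>\<^sub>E (UNIV :: complex set)"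

definition fun_zero :: "'a set \<Rightarrow> 'a \<Rightarrow> complex" where
  "fun_zero V = (\<lambda>w\<in>V. 0)"

definition fun_add :: "'a set \<Rightarrow> ('a \<Rightarrow> complex) \<Rightarrow> ('a \<Rightarrow> complex) \<Rightarrow> 'a \<Rightarrow> complex" where
  "fun_add V x y = (\<lambda>w\<in>V. x w + y w)"

definition fun_diff :: "'a set \<Rightarrow> ('a \<Rightarrow> complex) \<Rightarrow> ('a \<Rightarrow> complex) \<Rightarrow> 'a \<Rightarrow> complex" where
  "fun_diff V x y = (\<lambda>w\<in>V. x w - y w)"

definition fun_scale :: "'a set \<Rightarrow> complex \<Rightarrow> ('a \<Rightarrow> complex) \<Rightarrow> 'a \<Rightarrow> complex" where
  "fun_scale V c x = (\<lambda>w\<in>V. c * x w)"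

definition char_fun :: "'a set \<Rightarrow> 'a set \<Rightarrow> 'a \<Rightarrow> complex" where
  "char_fun V U = (\<lambda>w\<in>V. indicator U w)"

definition x_vec :: "'a set \<Rightarrow> 'a \<Rightarrow> 'a \<Rightarrow> 'a \<Rightarrow> complex" where
  "x_vec V u v = fun_diff V (char_fun V {v}) (char_fun V {u})"

text \<open>The values of an operator outside \<open>fun_space V\<close> are irrelevant and left unconstrained.\<close>

definition linear_operator :: "'a set \<Rightarrow> (('a \<Rightarrow> complex) \<Rightarrow> 'a \<Rightarrow> complex) \<Rightarrow> bool" where
  "linear_operator V T \<longleftrightarrow>
     T \<in> fun_space V \<rightarrow> fun_space V \<and>
     (\<forall>x\<in>fun_space V. \<forall>y\<in>fun_space V. T (fun_add V x y) = fun_add V (T x) (T y)) \<and>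
     (\<forall>c. \<forall>x\<in>fun_space V. T (fun_scale V c x) = fun_scale V c (T x))"

text \<open>
  For \<open>u\<close> and \<open>v\<close> in \<open>V\<close>, the map \<open>transpose u v\<close> permutes \<open>V\<close> and fixes all points outside, so
  composition with it preserves \<open>fun_space V\<close>.
\<close>

definition compatible ::
  "'a set \<Rightarrow> ('a \<times> 'a) set \<Rightarrow> (('a \<Rightarrow> complex) \<Rightarrow> 'a \<Rightarrow> complex) \<Rightarrow> bool" where
  "compatible V R T \<longleftrightarrow>
     (\<forall>W\<in>V // R. \<forall>u\<in>W. \<forall>v\<in>W. u \<noteq> v \<longrightarrow>
        (\<forall>x\<in>fun_space V. T x \<circ> transpose u v = T (x \<circ> transpose u v)))"

definition is_eigenvector ::
  "'a set \<Rightarrow> (('a \<Rightarrow> complex) \<Rightarrow> 'a \<Rightarrow> complex) \<Rightarrow> complex \<Rightarrow> ('a \<Rightarrow> complex) \<Rightarrow> bool" where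
  "is_eigenvector V T c x \<longleftrightarrow> x \<in> fun_space V \<and> x \<noteq> fun_zero V \<and> T x = fun_scale V c x"

definition is_eigenvalue ::
  "'a set \<Rightarrow> (('a \<Rightarrow> complex) \<Rightarrow> 'a \<Rightarrow> complex) \<Rightarrow> complex \<Rightarrow> bool" where
  "is_eigenvalue V T c \<longleftrightarrow> (\<exists>x. is_eigenvector V T c x)"

end

theory Submission imports Defs begin

text \<open>
  Call a function on \<open>V\<close> antisymmetric in \<open>u\<close> and \<open>v\<close> if interchanging the two vertices changes
  its sign. Such a function vanishes at every vertex \<open>w\<close> other than \<open>u\<close> and \<open>v\<close>, because \<open>w\<close> is
  fixed by the transposition, so that the value there equals its own negative; and its values at
  \<open>u\<close> and \<open>v\<close> are opposite. The antisymmetric functions therefore form the line spanned by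
  \<open>x_vec V u v\<close>, and the coefficient of a function on this line is its value at \<open>v\<close>
  (\<open>antisymmetric_imp_multiple\<close>). A linear operator that commutes with the transposition maps this
  line into itself, so \<open>x_vec V u v\<close> is an eigenvector and its eigenvalue is the value of its image
  at \<open>v\<close>.
\<close>

lemma x_vec_in_fun_space: "x_vec V u v \<in> fun_space V"
  by (auto simp: x_vec_def fun_diff_def fun_space_def)

lemma x_vec_nonzero:
  assumes "v \<in> V" "u \<noteq> v"
  shows "x_vec V u v \<noteq> fun_zero V"
proof
  assume "x_vec V u v = fun_zero V"
  then have "x_vec V u v v = fun_zero V v" by simp
  with assms show False
    by (simp add: x_vec_def fun_diff_def fun_zero_def char_fun_def)
qed

lemma x_vec_antisymmetric:
  assumes "u \<in> V" "v \<in> V"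
  shows "x_vec V u v \<circ> transpose u v = fun_scale V (-1) (x_vec V u v)"
  using assms
  by (auto simp: fun_eq_iff x_vec_def fun_diff_def fun_scale_def char_fun_def
      transpose_def indicator_def)

lemma antisymmetric_imp_multiple:
  assumes y: "y \<in> fun_space V" and "u \<in> V" "v \<in> V" "u \<noteq> v"
    and anti: "y \<circ> transpose u v = fun_scale V (-1) y"
  shows "y = fun_scale V (y v) (x_vec V u v)"
proof
  fix w
  have swap: "y (transpose u v z) = - y z" if "z \<in> V" for z
    using fun_cong[OF anti, of z] that by (simp add: fun_scale_def)
  consider "w \<notin> V" | "w = u" | "w = v" | "w \<in> V" "w \<noteq> u" "w \<noteq> v" by blast
  then show "y w = fun_scale V (y v) (x_vec V u v) w"
  proof cases
    case 1
    with y show ?thesis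
      by (auto simp: fun_space_def fun_scale_def PiE_def extensional_def)
  next
    case 2
    with swap[of v] assms show ?thesis
      by (simp add: fun_scale_def x_vec_def fun_diff_def char_fun_def)
  next
    case 3
    with assms show ?thesis
      by (simp add: fun_scale_def x_vec_def fun_diff_def char_fun_def)
  next
    case 4
    with swap[of w] have "y w = 0" by simp
    with 4 show ?thesis
      by (simp add: fun_scale_def x_vec_def fun_diff_def char_fun_def)
  qed
qed

theorem theorem2p4:
  fixes V :: "'a set" and E :: "'a set set"
    and R :: "('a \<times> 'a) set"
    and T :: "('a \<Rightarrow> complex) \<Rightarrow> 'a \<Rightarrow> complex"
    and W :: "'a set" and u v :: 'a
  assumes "hypergraph V E"
    and "equiv V R"
    and "linear_operator V T"
    and "compatible V R T"
    and "W \<in> V // R"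
    and "card W > 1"
    and "u \<in> W" and "v \<in> W" and "u \<noteq> v"
  shows "is_eigenvalue V T (T (x_vec V u v) v) \<and>
         is_eigenvector V T (T (x_vec V u v) v) (x_vec V u v)"
proof -
  let ?x = "x_vec V u v"
  have "W \<subseteq> V"
    using assms(2,5) Union_quotient by blast
  with assms(7,8) have uv: "u \<in> V" "v \<in> V" by auto
  have x: "?x \<in> fun_space V" by (rule x_vec_in_fun_space)
  have Tx: "T ?x \<in> fun_space V"
    using assms(3) x by (auto simp: linear_operator_def)
  have "T ?x \<circ> transpose u v = T (?x \<circ> transpose u v)"
    using assms(4,5,7-9) x unfolding compatible_def by blast
  also have "\<dots> = T (fun_scale V (-1) ?x)"
    using x_vec_antisymmetric[OF uv] by simp
  also have "\<dots> = fun_scale V (-1) (T ?x)"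
    using assms(3) x unfolding linear_operator_def by blast
  finally have "T ?x = fun_scale V (T ?x v) ?x"
    by (rule antisymmetric_imp_multiple[OF Tx uv assms(9)])
  then have "is_eigenvector V T (T ?x v) ?x"
    using x x_vec_nonzero[OF uv(2) assms(9)] by (simp add: is_eigenvector_def)
  then show ?thesis
    by (auto simp: is_eigenvalue_def)
qed

end
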